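(* Let $\gamma\in(\tfrac12,1)$ be fixed, and let $\rho\in(0,1]$, $C\ge0$, $\hat C\ge0$. Define $$M:=4\gamma^2+\frac{4\gamma}{1-\gamma}\cdot\frac{C+\hat C}{\rho},\qquad \delta:=\frac{\gamma(2\gamma-1)}{(3\gamma-1)\sqrt M}.$$ Let $G=\frac1n\sum_{i=1}^nG_i$ with $G_i:\mathbb{R}^p\to\mathbb{R}^p$, let $T:\mathbb{R}^p\rightrightarrows2^{\mathbb{R}^p}$, and suppose that: (i) $\{x:0\in Gx+Tx\}\ne\emptyset$; (ii) $T$ is maximally monotone; (iii) there is $L>0$ such that $\frac1n\sum_{i=1}^n\|G_ix-G_iy\|^2\le L^2\|x-y\|^2$ for all $x,y\in\mathbb{R}^p$; (iv) there exist $x^\star$ with $0\in Gx^\star+Tx^\star$ and $\kappa\ge0$ such that $\langle Gx+v,x-x^\star\rangle\ge-\kappa\|Gx+v\|^2$ for all $x\in\mathrm{dom}(T)$ and $v\in Tx$, and $L\kappa<\delta$. Let $\{(x^k,v^k)\}_{k\ge0}$ be generated from $x^0\in\mathrm{dom}(T)$ and $v^0\in Tx^0$ by the scheme (VFRBS) $$x^{k+1}=x^k-\eta\widetilde S^k_\gamma-\eta\big(\gamma v^{k+1}-(2\gamma-1)v^k\big),\qquad v^{k+1}\in Tx^{k+1},\quad k\ge0,$$ where $\widetilde S^0_\gamma=(1-\gamma)Gx^0$ and $\widetilde S^k_\gamma$ is a stochastic unbiased variance-reduced estimator (see context) of $S^k_\gamma:=Gx^k-\gamma Gx^{k-1}$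 with constants $\rho,C,\hat C$, and where the fixed learning rate $\eta>0$ satisfies $$\frac{(3\gamma-1)\kappa}{\gamma(2\gamma-1)}<\eta\le\frac1{L\sqrt M}.$$ Then, for every $K\ge0$, $$\frac1{K+1}\sum_{k=0}^K\mathbb{E}\big[\|Gx^k+v^k\|^2\big]\le\frac{\hat\Theta_1\hat R_0^2}{\eta^2(K+1)},\qquad\frac1{K+1}\sum_{k=0}^K\mathbb{E}\big[\|x^k-x^{k-1}\|^2\big]\le\frac{\hat\Theta_2\hat R_0^2}{K+1},$$ where $$\hat R_0^2:=\|x^0-x^\star\|^2+\gamma^2\eta^2\|Gx^0+v^0\|^2,\quad \hat\Theta_1:=\frac{(3\gamma-1)\eta}{(1-\gamma)[\gamma(2\gamma-1)\eta-(3\gamma-1)\kappa]},\quad \hat\Theta_2:=\frac{4(3\gamma-1)}{(1-\gamma)(1-ML^2\eta^2)},$$ with $\hat\Theta_2$ understood as $+\infty$ (second bound vacuous) if $\eta=\frac1{L\sqrt M}$.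
   Context: Norms and inner products are Euclidean on $\mathbb{R}^p$; $x^0,v^0$ are deterministic and by convention $x^{-1}=x^{-2}:=x^0$. The scheme is well defined: with the resolvent $J_{\gamma\eta T}:=(I+\gamma\eta T)^{-1}$ it reads $x^{k+1}=J_{\gamma\eta T}\big(x^k-\eta\widetilde S^k_\gamma+(2\gamma-1)\eta v^k\big)$, and then $v^{k+1}$ is determined by the displayed recursion. $\mathcal{F}_k$ is the $\sigma$-algebra generated by the iterates up to iteration $k$, i.e. $\mathcal{F}_k=\sigma(x^0,v^0,\dots,x^k,v^k)$; $\mathbb{E}_k[\cdot]:=\mathbb{E}[\cdot\mid\mathcal{F}_k]$ and $\mathbb{E}[\cdot]$ is the total expectation. Definition (stochastic unbiased variance-reduced estimator). $\widetilde S^k_\gamma$ is such an estimator of $S^k_\gamma:=Gx^k-\gamma Gx^{k-1}$ with constants $\rho\in(0,1]$, $C\ge0$, $\hat C\ge0$ if there is a nonnegative sequence $\{\Delta_k\}$, with $\Delta_{-1}=0$, such that for all $k\ge0$: $\mathbb{E}_k[\widetilde S^k_\gamma-S^k_\gamma]=0$; $\ \mathbb{E}[\|\widetilde S^k_\gamma-S^k_\gamma\|^2]\le\Delta_k$; and $\ \Delta_k\le(1-\rho)\Delta_{k-1}+C\,U_k+\hat C\,U_{k-1}$, where $U_k:=\frac1n\sum_{i=1}^n\mathbb{E}[\|G_ix^k-G_ix^{k-1}\|^2]$ (so $U_0=U_{-1}=0$). *)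

theory Defs
  imports "HOL-Probability.Probability"
begin

section \<open>Set-valued operators\<close>

definition op_dom :: "('a \<Rightarrow> 'b set) \<Rightarrow> 'a set" where
  "op_dom T = {x. T x \<noteq> {}}"

definition monotone_operator :: "('a::real_inner \<Rightarrow> 'a set) \<Rightarrow> bool" where
  "monotone_operator T \<longleftrightarrow> (\<forall>x y. \<forall>u\<in>T x. \<forall>v\<in>T y. inner (u - v) (x - y) \<ge> 0)"

text \<open>Maximality is with respect to inclusion of graphs.\<close>

definition maximally_monotone :: "('a::real_inner \<Rightarrow> 'a set) \<Rightarrow> bool" where
  "maximally_monotone T \<longleftrightarrow> monotone_operator T \<and>
     (\<forall>T'. monotone_operator T' \<and> (\<forall>x. T x \<subseteq> T' x) \<longrightarrow> T' = T)"

definition op_zeros :: "('a::real_vector \<Rightarrow> 'a) \<Rightarrow> ('a \<Rightarrow> 'a set) \<Rightarrow> 'a set" where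
  "op_zeros G T = {x. 0 \<in> {G x + v | v. v \<in> T x}}"

definition avg_op :: "nat \<Rightarrow> (nat \<Rightarrow> 'a::real_vector \<Rightarrow> 'a) \<Rightarrow> 'a \<Rightarrow> 'a" where
  "avg_op n Gi x = (1 / real n) *\<^sub>R (\<Sum>i=1..n. Gi i x)"


section \<open>Unbiased variance-reduced estimators\<close>

text \<open>
  Sequences are indexed by natural numbers; \<open>lag a s k\<close> is the term \<open>s (k - 1)\<close>, with the value
  \<open>a\<close> at index \<open>-1\<close>.  So \<open>lag (x 0) x k\<close> stands for the previous iterate under the convention
  that the iterate with index \<open>-1\<close> is the initial point.
\<close>

definition lag :: "'b \<Rightarrow> (nat \<Rightarrow> 'b) \<Rightarrow> nat \<Rightarrow> 'b" where
  "lag a s k = (case k of 0 \<Rightarrow> a | Suc j \<Rightarrow> s j)"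

definition reflected_dir ::
    "('a::real_vector \<Rightarrow> 'a) \<Rightarrow> real \<Rightarrow> (nat \<Rightarrow> 'w \<Rightarrow> 'a) \<Rightarrow> nat \<Rightarrow> 'w \<Rightarrow> 'a" where
  "reflected_dir G \<gamma> x k \<omega> = G (x k \<omega>) - \<gamma> *\<^sub>R G (lag (x 0) x k \<omega>)"

text \<open>
  This is a sub-sigma-algebra of \<open>P\<close> when all iterates are measurable.  That holds as soon as the
  estimators are measurable: the next iterate is the value of the resolvent of a monotone operator,
  which is single-valued and nonexpansive on its domain, at a measurable point.
\<close>

definition iterate_algebra ::
    "'w measure \<Rightarrow> (nat \<Rightarrow> 'w \<Rightarrow> 'a::topological_space) \<Rightarrow> (nat \<Rightarrow> 'w \<Rightarrow> 'a) \<Rightarrow> nat \<Rightarrow> 'w measure" where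
  "iterate_algebra P x v k =
     sigma (space P) (\<Union>j\<le>k. {x j -` A \<inter> space P | A. A \<in> sets borel} \<union>
                             {v j -` A \<inter> space P | A. A \<in> sets borel})"

text \<open>The library's conditional expectation is real-valued; for random vectors it is taken
  componentwise.\<close>

definition vec_cond_exp ::
    "'w measure \<Rightarrow> 'w measure \<Rightarrow> ('w \<Rightarrow> real^'p) \<Rightarrow> 'w \<Rightarrow> real^'p" where
  "vec_cond_exp P F f \<omega> = (\<chi> i. real_cond_exp P F (\<lambda>\<omega>. f \<omega> $ i) \<omega>)"

definition mean_sq_change ::
    "'w measure \<Rightarrow> nat \<Rightarrow> (nat \<Rightarrow> real^'p \<Rightarrow> real^'p) \<Rightarrow> (nat \<Rightarrow> 'w \<Rightarrow> real^'p) \<Rightarrow> nat \<Rightarrow> real" where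
  "mean_sq_change P n Gi x k =
     (1 / real n) *
     (\<Sum>i=1..n. \<integral>\<omega>. (norm (Gi i (x k \<omega>) - Gi i (lag (x 0) x k \<omega>)))\<^sup>2 \<partial>P)"

text \<open>
  Since the Bochner integral of a non-integrable function is \<open>0\<close>, finiteness of the second moment
  of the error is stated separately.
\<close>

definition unbiased_vr_estimator ::
    "'w measure \<Rightarrow> nat \<Rightarrow> (nat \<Rightarrow> real^'p \<Rightarrow> real^'p) \<Rightarrow> real \<Rightarrow>
     (nat \<Rightarrow> 'w \<Rightarrow> real^'p) \<Rightarrow> (nat \<Rightarrow> 'w \<Rightarrow> real^'p) \<Rightarrow>
     real \<Rightarrow> real \<Rightarrow> real \<Rightarrow> (nat \<Rightarrow> 'w \<Rightarrow> real^'p) \<Rightarrow> bool" where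
  "unbiased_vr_estimator P n Gi \<gamma> x v \<rho> C C' S \<longleftrightarrow>
     (let err = (\<lambda>k \<omega>. S k \<omega> - reflected_dir (avg_op n Gi) \<gamma> x k \<omega>);
          U = mean_sq_change P n Gi x
      in (\<forall>k. S k \<in> borel_measurable P) \<and>
         (\<exists>\<Delta>::nat \<Rightarrow> real. \<forall>k.
            \<Delta> k \<ge> 0 \<and>
            (AE \<omega> in P. vec_cond_exp P (iterate_algebra P x v k) (err k) \<omega> = 0) \<and>
            integrable P (\<lambda>\<omega>. (norm (err k \<omega>))\<^sup>2) \<and>
            (\<integral>\<omega>. (norm (err k \<omega>))\<^sup>2 \<partial>P) \<le> \<Delta> k \<and>
            \<Delta> k \<le> (1 - \<rho>) * lag 0 \<Delta> k + C * U k + C' * lag 0 U k))"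


section \<open>Constants\<close>

definition vfrbs_M :: "real \<Rightarrow> real \<Rightarrow> real \<Rightarrow> real \<Rightarrow> real" where
  "vfrbs_M \<gamma> \<rho> C C' = 4 * \<gamma>\<^sup>2 + 4 * \<gamma> / (1 - \<gamma>) * ((C + C') / \<rho>)"

definition vfrbs_delta :: "real \<Rightarrow> real \<Rightarrow> real \<Rightarrow> real \<Rightarrow> real" where
  "vfrbs_delta \<gamma> \<rho> C C' = \<gamma> * (2 * \<gamma> - 1) / ((3 * \<gamma> - 1) * sqrt (vfrbs_M \<gamma> \<rho> C C'))"

definition vfrbs_Theta1 :: "real \<Rightarrow> real \<Rightarrow> real \<Rightarrow> real" where
  "vfrbs_Theta1 \<gamma> \<kappa> \<eta> =
     (3 * \<gamma> - 1) * \<eta> / ((1 - \<gamma>) * (\<gamma> * (2 * \<gamma> - 1) * \<eta> - (3 * \<gamma> - 1) * \<kappa>))"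

definition vfrbs_Theta2 :: "real \<Rightarrow> real \<Rightarrow> real \<Rightarrow> real \<Rightarrow> real \<Rightarrow> real \<Rightarrow> real" where
  "vfrbs_Theta2 \<gamma> \<rho> C C' L \<eta> =
     4 * (3 * \<gamma> - 1) / ((1 - \<gamma>) * (1 - vfrbs_M \<gamma> \<rho> C C' * L\<^sup>2 * \<eta>\<^sup>2))"

end

theory Submission
  imports Defs
begin

text \<open>
  Write \<open>w k = G (x k) + v k\<close> for the residual, \<open>w' k = G (x (k - 1)) + v k\<close> for its lagged version
  and \<open>e k\<close> for the error of the estimator.  The scheme is, in disguise, a plain stochastic forward
  step: the shifted points \<open>y k = x k + \<gamma> \<eta> w' k\<close> satisfy
  \<open>y (k + 1) = y k - \<eta> (1 - \<gamma>) w k - \<eta> e k\<close> (lemma \<open>shifted_error_step\<close>).  Expanding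
  \<open>\<parallel>y (k + 1) - xstar\<parallel>\<^sup>2\<close> produces the product of \<open>w k\<close> with \<open>x k - xstar\<close>, which the weak Minty
  condition bounds below by \<open>- \<kappa> \<parallel>w k\<parallel>\<^sup>2\<close>, and the product of \<open>w k\<close> with \<open>w' k\<close>, which is nearly a square because
  \<open>w k - w' k = G (x k) - G (x (k - 1))\<close> is controlled by the last displacement.  The products
  with \<open>e k\<close> vanish in expectation, since everything else is determined by the past.

  With \<open>z k = (1 - \<gamma>) w k - \<gamma> w' k\<close>, the displacement is
  \<open>x (k + 1) - x k = - \<eta> (\<gamma> w' (k + 1) + (z k + e k))\<close>, so its second moment is at most
  \<open>2 \<eta>\<^sup>2 (\<gamma>\<^sup>2 E\<parallel>w' (k + 1)\<parallel>\<^sup>2 + E\<parallel>z k\<parallel>\<^sup>2 + E\<parallel>e k\<parallel>\<^sup>2)\<close>.  The weight \<open>3 \<gamma> - 1\<close> in front of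
  \<open>\<parallel>y k - xstar\<parallel>\<^sup>2\<close> is the one for which the descent inequality contains, with a negative sign, exactly
  the sum \<open>\<gamma>\<^sup>2 E\<parallel>w' k\<parallel>\<^sup>2 + E\<parallel>z k\<parallel>\<^sup>2 + E\<parallel>e k\<parallel>\<^sup>2\<close> of these three terms, next to the gain in
  \<open>E\<parallel>w k\<parallel>\<^sup>2\<close> (lemmas \<open>descent_identity\<close> and \<open>expected_shifted_error_descent\<close>; the weight of
  \<open>E\<parallel>e k\<parallel>\<^sup>2\<close> is split as \<open>3 \<gamma> - 1 = 2 \<gamma> - (1 - \<gamma>)\<close>).  Summed over \<open>k\<close>, these
  terms dominate \<open>(1 - \<gamma>) / 2\<close> times the total squared displacement.  What has to be paid for is
  \<open>2 \<gamma> \<eta>\<^sup>2\<close> times \<open>\<gamma> (1 - \<gamma>) \<parallel>w k - w' k\<parallel>\<^sup>2 + \<parallel>e k\<parallel>\<^sup>2\<close>; the Lipschitz condition and the summed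
  variance recursion (lemma \<open>sum_variance_recursion\<close>) bound its total by
  \<open>(1 - \<gamma>) / 2 \<cdot> M L\<^sup>2 \<eta>\<^sup>2\<close> times the same total displacement, which is how the constant \<open>M\<close> arises and
  why \<open>M L\<^sup>2 \<eta>\<^sup>2 \<le> 1\<close> is the right step size restriction.  The outcome is lemma \<open>summed_descent\<close>, and
  both bounds are read off from it.

  Taking expectations requires the iterates to be measurable and square-integrable.  Here
  monotonicity enters: \<open>x (k + 1)\<close> is a nonexpansive function, the resolvent, of a random vector that
  is already known to be square-integrable.
\<close>

section \<open>Square-integrable random vectors\<close>

definition sq_integrable :: "'w measure \<Rightarrow> ('w \<Rightarrow> 'b::euclidean_space) \<Rightarrow> bool" where
  "sq_integrable M f \<longleftrightarrow> f \<in> borel_measurable M \<and> integrable M (\<lambda>\<omega>. (norm (f \<omega>))\<^sup>2)"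

lemma sq_integrableD:
  assumes "sq_integrable M f"
  shows "f \<in> borel_measurable M" "integrable M (\<lambda>\<omega>. (norm (f \<omega>))\<^sup>2)"
  using assms by (auto simp: sq_integrable_def)

lemma sq_integrable_cong:
  assumes "\<And>\<omega>. \<omega> \<in> space M \<Longrightarrow> f \<omega> = g \<omega>"
  shows "sq_integrable M f \<longleftrightarrow> sq_integrable M g"
  unfolding sq_integrable_def
  using assms by (intro conj_cong measurable_cong Bochner_Integration.integrable_cong) auto

lemma sq_integrable_scaleR:
  "sq_integrable M f \<Longrightarrow> sq_integrable M (\<lambda>\<omega>. c *\<^sub>R f \<omega>)"
  by (auto simp: sq_integrable_def power_mult_distrib)

lemma norm_add_sq_le: "(norm (a + b))\<^sup>2 \<le> 2 * (norm a)\<^sup>2 + 2 * (norm b)\<^sup>2"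
  for a b :: "'a::real_inner"
proof -
  have "(norm (a + b))\<^sup>2 + (norm (a - b))\<^sup>2 = 2 * (norm a)\<^sup>2 + 2 * (norm b)\<^sup>2"
    by (simp add: power2_norm_eq_inner algebra_simps inner_commute)
  then show ?thesis
    by (smt (verit) zero_le_power2)
qed

lemma sq_integrable_add:
  assumes "sq_integrable M f" "sq_integrable M g"
  shows "sq_integrable M (\<lambda>\<omega>. f \<omega> + g \<omega>)"
proof -
  note [measurable] = sq_integrableD(1)[OF assms(1)] sq_integrableD(1)[OF assms(2)]
  have "integrable M (\<lambda>\<omega>. 2 * (norm (f \<omega>))\<^sup>2 + 2 * (norm (g \<omega>))\<^sup>2)"
    using assms by (auto simp: sq_integrable_def)
  then have "integrable M (\<lambda>\<omega>. (norm (f \<omega> + g \<omega>))\<^sup>2)"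
    by (rule Bochner_Integration.integrable_bound) (use norm_add_sq_le in auto)
  then show ?thesis
    by (simp add: sq_integrable_def)
qed

lemma sq_integrable_diff:
  assumes "sq_integrable M f" "sq_integrable M g"
  shows "sq_integrable M (\<lambda>\<omega>. f \<omega> - g \<omega>)"
  using sq_integrable_add[OF assms(1) sq_integrable_scaleR[OF assms(2), of "-1"]] by simp

lemma sq_integrable_const:
  assumes "finite_measure M"
  shows "sq_integrable M (\<lambda>\<omega>. c)"
  using finite_measure.integrable_const[OF assms] by (simp add: sq_integrable_def)

lemmas sq_integrable_intros =
  sq_integrable_add sq_integrable_diff sq_integrable_scaleR

lemma sq_integrable_bound:
  assumes "sq_integrable M g" "f \<in> borel_measurable M"
    and "\<And>\<omega>. \<omega> \<in> space M \<Longrightarrow> norm (f \<omega>) \<le> norm (g \<omega>)"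
  shows "sq_integrable M f"
proof -
  note [measurable] = assms(2)
  have "integrable M (\<lambda>\<omega>. (norm (f \<omega>))\<^sup>2)"
    by (rule Bochner_Integration.integrable_bound[OF sq_integrableD(2)[OF assms(1)]])
      (use assms(3) in \<open>auto intro!: power_mono\<close>)
  then show ?thesis
    using assms(2) by (simp add: sq_integrable_def)
qed

lemma sq_integrable_lipschitz_diff:
  fixes F :: "'a::euclidean_space \<Rightarrow> 'b::euclidean_space"
  assumes F: "F \<in> borel_measurable borel" "\<And>y z. norm (F y - F z) \<le> B * norm (y - z)"
    and "sq_integrable M f" "sq_integrable M g"
  shows "sq_integrable M (\<lambda>\<omega>. F (f \<omega>) - F (g \<omega>))"
proof (rule sq_integrable_bound)
  show "sq_integrable M (\<lambda>\<omega>. B *\<^sub>R (f \<omega> - g \<omega>))"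
    using assms by (intro sq_integrable_intros)
  note [measurable] = sq_integrableD(1)[OF assms(3)] sq_integrableD(1)[OF assms(4)] F(1)
  show "(\<lambda>\<omega>. F (f \<omega>) - F (g \<omega>)) \<in> borel_measurable M"
    by measurable
  show "norm (F (f \<omega>) - F (g \<omega>)) \<le> norm (B *\<^sub>R (f \<omega> - g \<omega>))" for \<omega>
    using F(2)[of "f \<omega>" "g \<omega>"] mult_right_mono[OF abs_ge_self[of B], of "norm (f \<omega> - g \<omega>)"]
    by simp
qed

lemma sq_integrable_lipschitz:
  fixes F :: "'a::euclidean_space \<Rightarrow> 'b::euclidean_space"
  assumes "finite_measure M"
    and "F \<in> borel_measurable borel" "\<And>y z. norm (F y - F z) \<le> B * norm (y - z)"
    and "sq_integrable M f"
  shows "sq_integrable M (\<lambda>\<omega>. F (f \<omega>))"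
  using sq_integrable_add[OF sq_integrable_lipschitz_diff[OF assms(2,3,4)
        sq_integrable_const[OF assms(1), of 0]] sq_integrable_const[OF assms(1), of "F 0"]]
  by simp

lemma borel_measurable_lipschitz:
  fixes F :: "'a::euclidean_space \<Rightarrow> 'b::euclidean_space"
  assumes "\<And>y z. norm (F y - F z) \<le> B * norm (y - z)" "B \<ge> 0"
  shows "F \<in> borel_measurable borel"
proof (rule borel_measurable_continuous_onI)
  have "B-lipschitz_on UNIV F"
    using assms by (intro lipschitz_onI) (auto simp: dist_norm)
  then show "continuous_on UNIV F"
    by (rule lipschitz_on_continuous_on)
qed

lemma integrable_mult_sq_integrable:
  fixes f g :: "'w \<Rightarrow> real"
  assumes "sq_integrable M f" "sq_integrable M g"
  shows "integrable M (\<lambda>\<omega>. f \<omega> * g \<omega>)"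
proof -
  note [measurable] = sq_integrableD(1)[OF assms(1)] sq_integrableD(1)[OF assms(2)]
  have "integrable M (\<lambda>\<omega>. (norm (f \<omega>))\<^sup>2 + (norm (g \<omega>))\<^sup>2)"
    using assms by (auto simp: sq_integrable_def)
  then show ?thesis
  proof (rule Bochner_Integration.integrable_bound)
    have "\<bar>a * b\<bar> \<le> a\<^sup>2 + b\<^sup>2" for a b :: real
      using sum_squares_bound[of "\<bar>a\<bar>" "\<bar>b\<bar>"] abs_ge_zero[of "a * b"]
      unfolding abs_mult power2_abs by linarith
    then show "AE \<omega> in M. norm (f \<omega> * g \<omega>) \<le> norm ((norm (f \<omega>))\<^sup>2 + (norm (g \<omega>))\<^sup>2)"
      by simp
  qed simp
qed

lemma sq_integrable_component:
  fixes f :: "'w \<Rightarrow> real^'p"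
  assumes "sq_integrable M f"
  shows "sq_integrable M (\<lambda>\<omega>. f \<omega> $ i)"
proof (rule sq_integrable_bound[OF assms])
  show "(\<lambda>\<omega>. f \<omega> $ i) \<in> borel_measurable M"
    using sq_integrableD(1)[OF assms] by (rule borel_measurable_continuous_on[rotated]) (intro continuous_intros)
  show "norm (f \<omega> $ i) \<le> norm (f \<omega>)" for \<omega>
    by (simp add: component_le_norm_cart)
qed

text \<open>
  A factor that is measurable with respect to the smaller sigma-algebra can be pulled into the
  conditional expectation, one coordinate at a time.
\<close>

lemma (in finite_measure_subalgebra) expectation_inner_eq_0:
  fixes f e :: "'a \<Rightarrow> real^'p"
  assumes f: "sq_integrable M f" "f \<in> borel_measurable F"
    and e: "sq_integrable M e" "AE \<omega> in M. vec_cond_exp M F e \<omega> = 0"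
  shows "integrable M (\<lambda>\<omega>. inner (f \<omega>) (e \<omega>))" "(\<integral>\<omega>. inner (f \<omega>) (e \<omega>) \<partial>M) = 0"
proof -
  have int: "integrable M (\<lambda>\<omega>. f \<omega> $ i * e \<omega> $ i)" for i
    by (intro integrable_mult_sq_integrable sq_integrable_component f e)
  then show "integrable M (\<lambda>\<omega>. inner (f \<omega>) (e \<omega>))"
    by (simp add: inner_vec_def)
  have "(\<integral>\<omega>. f \<omega> $ i * e \<omega> $ i \<partial>M) = 0" for i
  proof -
    have "(\<integral>\<omega>. f \<omega> $ i * e \<omega> $ i \<partial>M)
        = (\<integral>\<omega>. f \<omega> $ i * real_cond_exp M F (\<lambda>\<omega>. e \<omega> $ i) \<omega> \<partial>M)"
    proof (rule real_cond_exp_intg(2)[symmetric, OF int])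
      show "(\<lambda>\<omega>. f \<omega> $ i) \<in> borel_measurable F"
        using f(2) by (rule borel_measurable_continuous_on[rotated]) (intro continuous_intros)
      show "(\<lambda>\<omega>. e \<omega> $ i) \<in> borel_measurable M"
        by (rule sq_integrableD(1)[OF sq_integrable_component[OF e(1)]])
    qed
    also have "\<dots> = 0"
      using e(2) by (intro integral_eq_zero_AE) (auto simp: vec_cond_exp_def vec_eq_iff)
    finally show ?thesis .
  qed
  then show "(\<integral>\<omega>. inner (f \<omega>) (e \<omega>) \<partial>M) = 0"
    using int by (simp add: inner_vec_def)
qed

lemma (in finite_measure_subalgebra) expectation_sq_add_unbiased:
  fixes f e :: "'a \<Rightarrow> real^'p"
  assumes f: "sq_integrable M f" "f \<in> borel_measurable F"
    and e: "sq_integrable M e" "AE \<omega> in M. vec_cond_exp M F e \<omega> = 0"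
  shows "(\<integral>\<omega>. (norm (f \<omega> + c *\<^sub>R e \<omega>))\<^sup>2 \<partial>M)
       = (\<integral>\<omega>. (norm (f \<omega>))\<^sup>2 \<partial>M) + c\<^sup>2 * (\<integral>\<omega>. (norm (e \<omega>))\<^sup>2 \<partial>M)"
proof -
  have "(norm (f \<omega> + c *\<^sub>R e \<omega>))\<^sup>2
      = (norm (f \<omega>))\<^sup>2 + 2 * c * inner (f \<omega>) (e \<omega>) + c\<^sup>2 * (norm (e \<omega>))\<^sup>2" for \<omega>
    unfolding power2_norm_eq_inner by (simp add: algebra_simps inner_commute power2_eq_square)
  then show ?thesis
    using expectation_inner_eq_0[OF f e] sq_integrableD(2)[OF f(1)] sq_integrableD(2)[OF e(1)]
    by simp
qed

section \<open>Resolvents of monotone operators\<close>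

lemma monotone_resolvent_nonexpansive:
  assumes T: "monotone_operator T" and c: "c \<ge> 0" and u: "u \<in> T a" and v: "v \<in> T b"
  shows "norm (a - b) \<le> norm ((a + c *\<^sub>R u) - (b + c *\<^sub>R v))"
proof -
  have "(norm (a - b))\<^sup>2 \<le> inner ((a + c *\<^sub>R u) - (b + c *\<^sub>R v)) (a - b)"
  proof -
    have "0 \<le> c * inner (u - v) (a - b)"
      using T u v c by (auto simp: monotone_operator_def)
    then show ?thesis
      by (simp add: power2_norm_eq_inner algebra_simps)
  qed
  also have "\<dots> \<le> norm ((a + c *\<^sub>R u) - (b + c *\<^sub>R v)) * norm (a - b)"
    by (rule norm_cauchy_schwarz)
  finally show ?thesis
    by (cases "a = b") (auto simp: power2_eq_square)
qed

text \<open>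
  The resolvent sends \<open>a \<omega> + c *\<^sub>R u \<omega>\<close> to \<open>a \<omega>\<close>.  Its domain, the range of \<open>I + c T\<close>, need not be a
  Borel set when \<open>T\<close> is merely monotone; being nonexpansive, the resolvent extends continuously to
  the closure of this domain, and the extension is a Borel function.
\<close>

lemma resolvent_measurable:
  fixes T :: "'a::euclidean_space \<Rightarrow> 'a set"
  assumes T: "monotone_operator T" and c: "c \<ge> 0"
    and Z: "(\<lambda>\<omega>. a \<omega> + c *\<^sub>R u \<omega>) \<in> borel_measurable M"
    and u: "\<And>\<omega>. \<omega> \<in> space M \<Longrightarrow> u \<omega> \<in> T (a \<omega>)"
  shows "a \<in> borel_measurable M"
proof -
  define R where "R = {b + c *\<^sub>R w | b w. w \<in> T b}"
  define J where "J z = (SOME b. \<exists>w \<in> T b. z = b + c *\<^sub>R w)" for z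
  have J: "\<exists>w \<in> T (J z). z = J z + c *\<^sub>R w" if "z \<in> R" for z
    unfolding J_def by (rule someI_ex) (use that in \<open>auto simp: R_def\<close>)
  have "1-lipschitz_on R J"
  proof (rule lipschitz_onI)
    fix z z' assume "z \<in> R" "z' \<in> R"
    then obtain w w' where w: "w \<in> T (J z)" "z = J z + c *\<^sub>R w"
      and w': "w' \<in> T (J z')" "z' = J z' + c *\<^sub>R w'"
      using J by meson
    show "dist (J z) (J z') \<le> 1 * dist z z'"
      using monotone_resolvent_nonexpansive[OF T c w(1) w'(1)] w(2) w'(2) by (simp add: dist_norm)
  qed simp
  then obtain g where g: "1-lipschitz_on (closure R) g" "\<forall>z\<in>R. g z = J z"
    using lipschitz_extend_closure by blast
  have "(\<lambda>z. indicator (closure R) z *\<^sub>R g z) \<in> borel_measurable borel"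
    by (intro borel_measurable_continuous_on_indicator lipschitz_on_continuous_on[OF g(1)]) auto
  from measurable_compose[OF Z this]
  show ?thesis
  proof (rule iffD1[OF measurable_cong, rotated])
    fix \<omega> assume \<omega>: "\<omega> \<in> space M"
    let ?z = "a \<omega> + c *\<^sub>R u \<omega>"
    have R: "?z \<in> R"
      using u[OF \<omega>] by (auto simp: R_def)
    obtain w where w: "w \<in> T (J ?z)" "?z = J ?z + c *\<^sub>R w"
      using J[OF R] by blast
    have "J ?z = a \<omega>"
      using monotone_resolvent_nonexpansive[OF T c w(1) u[OF \<omega>]] w(2)[symmetric] by simp
    then show "indicator (closure R) ?z *\<^sub>R g ?z = a \<omega>"
      using R g(2) closure_subset[of R] by (auto simp: indicator_def)
  qed
qed

section \<open>Averages of operators\<close>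

lemma norm_avg_op_diff_sq_le:
  fixes Gi :: "nat \<Rightarrow> 'a::real_inner \<Rightarrow> 'a"
  assumes "n \<ge> 1"
  shows "(norm (avg_op n Gi y - avg_op n Gi z))\<^sup>2
       \<le> (1 / real n) * (\<Sum>i=1..n. (norm (Gi i y - Gi i z))\<^sup>2)"
proof -
  have eq: "avg_op n Gi y - avg_op n Gi z = (1 / real n) *\<^sub>R (\<Sum>i=1..n. Gi i y - Gi i z)"
    by (simp add: avg_op_def sum_subtractf scaleR_diff_right)
  have "(norm (\<Sum>i=1..n. Gi i y - Gi i z))\<^sup>2 \<le> (\<Sum>i=1..n. norm (Gi i y - Gi i z))\<^sup>2"
    by (intro power_mono norm_sum) auto
  also have "\<dots> \<le> (\<Sum>i=1..n. (norm (Gi i y - Gi i z))\<^sup>2) * real n"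
    using sum_squared_le_sum_of_squares[of "\<lambda>i. norm (Gi i y - Gi i z)" "{1..n}"] by simp
  finally show ?thesis
    using assms by (simp add: eq power_divide divide_simps power2_eq_square algebra_simps)
qed

section \<open>Algebraic core of the descent\<close>

text \<open>
  The inner product of \<open>w\<close> and \<open>wh\<close> in the expansion of the left-hand side can be traded either for
  the norm of \<open>w - wh\<close> or for that of \<open>(1 - \<gamma>) *\<^sub>R w - \<gamma> *\<^sub>R wh\<close>.  The weight \<open>3 \<gamma> - 1 = 2 \<gamma> - (1 - \<gamma>)\<close>
  mixes the two so that, up to the factor \<open>\<eta>\<^sup>2 * (1 - \<gamma>)\<close>, the remaining multiple of the squared norm
  of \<open>wh\<close> is \<open>- \<gamma>\<^sup>2\<close>, matching its weight in the bound on a displacement, and that of \<open>w\<close> is negative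
  for \<open>1/2 < \<gamma> < 1\<close>.
\<close>

lemma descent_identity:
  fixes r w wh :: "'a::real_inner" and \<gamma> \<eta> :: real
  defines "y \<equiv> r + (\<gamma> * \<eta>) *\<^sub>R wh"
  shows "(3 * \<gamma> - 1) * (norm (y - (\<eta> * (1 - \<gamma>)) *\<^sub>R w))\<^sup>2
       = (3 * \<gamma> - 1) * (norm y)\<^sup>2 - 2 * \<eta> * (3 * \<gamma> - 1) * (1 - \<gamma>) * inner w r
         + \<eta>\<^sup>2 * (1 - \<gamma>) * (2 * \<gamma>\<^sup>2 * (norm (w - wh))\<^sup>2 - 2 * \<gamma> * (2 * \<gamma> - 1) * (norm w)\<^sup>2
             - (norm ((1 - \<gamma>) *\<^sub>R w - \<gamma> *\<^sub>R wh))\<^sup>2 - \<gamma>\<^sup>2 * (norm wh)\<^sup>2)"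
proof -
  have 1: "(norm (y - (\<eta> * (1 - \<gamma>)) *\<^sub>R w))\<^sup>2 = (norm y)\<^sup>2
      - 2 * \<eta> * (1 - \<gamma>) * (inner w r + \<gamma> * \<eta> * inner w wh) + (\<eta> * (1 - \<gamma>))\<^sup>2 * (norm w)\<^sup>2"
    unfolding power2_norm_eq_inner y_def
    by (simp add: algebra_simps inner_commute power2_eq_square)
  have 2: "(norm (w - wh))\<^sup>2 = (norm w)\<^sup>2 - 2 * inner w wh + (norm wh)\<^sup>2"
    unfolding power2_norm_eq_inner by (simp add: algebra_simps inner_commute)
  have 3: "(norm ((1 - \<gamma>) *\<^sub>R w - \<gamma> *\<^sub>R wh))\<^sup>2
      = (1 - \<gamma>)\<^sup>2 * (norm w)\<^sup>2 - 2 * \<gamma> * (1 - \<gamma>) * inner w wh + \<gamma>\<^sup>2 * (norm wh)\<^sup>2"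
    unfolding power2_norm_eq_inner by (simp add: algebra_simps inner_commute power2_eq_square)
  show ?thesis
    unfolding 1 2 3 by algebra
qed

text \<open>
  In the sum over \<open>k\<close> the lagged terms are dominated by the unlagged ones, so the factor \<open>1 - \<rho>\<close> can be
  absorbed on the left, which leaves the factor \<open>\<rho>\<close> there.
\<close>

lemma sum_variance_recursion:
  fixes \<Delta> U :: "nat \<Rightarrow> real"
  assumes \<rho>: "0 < \<rho>" "\<rho> \<le> 1" and C: "C \<ge> 0" "C' \<ge> 0"
    and \<Delta>: "\<And>k. \<Delta> k \<ge> 0" and U: "\<And>k. U k \<ge> 0"
    and rec: "\<And>k. \<Delta> k \<le> (1 - \<rho>) * lag 0 \<Delta> k + C * U k + C' * lag 0 U k"
  shows "(\<Sum>k=0..K. \<Delta> k) \<le> (C + C') / \<rho> * (\<Sum>k=0..K. U k)"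
proof -
  have lag_sum: "(\<Sum>k=0..K. lag 0 s k) \<le> (\<Sum>k=0..K. s k)" if "\<And>k. s k \<ge> (0::real)" for s
  proof -
    have "(\<Sum>k=0..K. lag 0 s k) = (\<Sum>k<K. s k)"
      by (simp add: sum.atLeast0_atMost_Suc_shift lag_def atLeast0AtMost sum.atMost_shift)
    also have "\<dots> \<le> (\<Sum>k=0..K. s k)"
      by (intro sum_mono2) (auto simp: that)
    finally show ?thesis .
  qed
  have "(\<Sum>k=0..K. \<Delta> k) \<le> (\<Sum>k=0..K. (1 - \<rho>) * lag 0 \<Delta> k + C * U k + C' * lag 0 U k)"
    by (intro sum_mono rec)
  also have "\<dots> = (1 - \<rho>) * (\<Sum>k=0..K. lag 0 \<Delta> k) + C * (\<Sum>k=0..K. U k) + C' * (\<Sum>k=0..K. lag 0 U k)"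
    by (simp add: sum.distrib sum_distrib_left)
  also have "\<dots> \<le> (1 - \<rho>) * (\<Sum>k=0..K. \<Delta> k) + C * (\<Sum>k=0..K. U k) + C' * (\<Sum>k=0..K. U k)"
    using \<rho> C by (intro add_mono mult_left_mono lag_sum \<Delta> U) auto
  finally have "\<rho> * (\<Sum>k=0..K. \<Delta> k) \<le> (C + C') * (\<Sum>k=0..K. U k)"
    by (simp add: algebra_simps)
  then show ?thesis
    using \<rho>(1) by (simp add: field_simps)
qed


section \<open>The stochastic process\<close>

text \<open>
  The sequence \<open>\<Delta>\<close> of variance bounds, existentially quantified in the definition of an estimator,
  is a parameter here.
\<close>

locale vfrbs = prob_space P
  for P :: "'w measure" +
  fixes n :: nat and Gi :: "nat \<Rightarrow> real^'p \<Rightarrow> real^'p" and T :: "real^'p \<Rightarrow> (real^'p) set"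
    and x v S :: "nat \<Rightarrow> 'w \<Rightarrow> real^'p" and x0 v0 xstar :: "real^'p"
    and \<gamma> \<rho> C C' L \<kappa> \<eta> :: real and \<Delta> :: "nat \<Rightarrow> real"
  assumes gamma: "1/2 < \<gamma>" "\<gamma> < 1"
    and rho: "0 < \<rho>" "\<rho> \<le> 1"
    and C_nonneg: "C \<ge> 0" "C' \<ge> 0"
    and n_pos: "n \<ge> 1"
    and T_monotone: "monotone_operator T"
    and L_pos: "L > 0"
    and Lipschitz:
      "\<And>y z. (1 / real n) * (\<Sum>i=1..n. (norm (Gi i y - Gi i z))\<^sup>2) \<le> L\<^sup>2 * (norm (y - z))\<^sup>2"
    and weak_Minty: "\<And>y u. u \<in> T y \<Longrightarrow>
         inner (avg_op n Gi y + u) (y - xstar) \<ge> - \<kappa> * (norm (avg_op n Gi y + u))\<^sup>2"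
    and init: "v0 \<in> T x0" "\<And>\<omega>. \<omega> \<in> space P \<Longrightarrow> x 0 \<omega> = x0" "\<And>\<omega>. \<omega> \<in> space P \<Longrightarrow> v 0 \<omega> = v0"
    and S_measurable: "\<And>k. S k \<in> borel_measurable P"
    and \<Delta>_nonneg: "\<And>k. \<Delta> k \<ge> 0"
    and unbiased: "\<And>k. AE \<omega> in P. vec_cond_exp P (iterate_algebra P x v k)
          (\<lambda>\<omega>. S k \<omega> - reflected_dir (avg_op n Gi) \<gamma> x k \<omega>) \<omega> = 0"
    and error_integrable:
      "\<And>k. integrable P (\<lambda>\<omega>. (norm (S k \<omega> - reflected_dir (avg_op n Gi) \<gamma> x k \<omega>))\<^sup>2)"
    and error_le:
      "\<And>k. (\<integral>\<omega>. (norm (S k \<omega> - reflected_dir (avg_op n Gi) \<gamma> x k \<omega>))\<^sup>2 \<partial>P) \<le> \<Delta> k"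
    and \<Delta>_rec: "\<And>k. \<Delta> k \<le> (1 - \<rho>) * lag 0 \<Delta> k + C * mean_sq_change P n Gi x k
                       + C' * lag 0 (mean_sq_change P n Gi x) k"
    and x_step: "\<And>k \<omega>. \<omega> \<in> space P \<Longrightarrow> x (Suc k) \<omega> = x k \<omega> - \<eta> *\<^sub>R S k \<omega>
           - \<eta> *\<^sub>R (\<gamma> *\<^sub>R v (Suc k) \<omega> - (2 * \<gamma> - 1) *\<^sub>R v k \<omega>)"
    and v_step: "\<And>k \<omega>. \<omega> \<in> space P \<Longrightarrow> v (Suc k) \<omega> \<in> T (x (Suc k) \<omega>)"
    and eta_pos: "\<eta> > 0"
begin

abbreviation "G \<equiv> avg_op n Gi"

abbreviation "prev k \<equiv> lag (x 0) x k"

definition err :: "nat \<Rightarrow> 'w \<Rightarrow> real^'p" where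
  "err k \<omega> = S k \<omega> - reflected_dir G \<gamma> x k \<omega>"

definition residual :: "nat \<Rightarrow> 'w \<Rightarrow> real^'p" where
  "residual k \<omega> = G (x k \<omega>) + v k \<omega>"

definition lagged_residual :: "nat \<Rightarrow> 'w \<Rightarrow> real^'p" where
  "lagged_residual k \<omega> = G (prev k \<omega>) + v k \<omega>"

text \<open>
  Up to sign and the factor \<open>\<eta>\<close>, the part of the next displacement that the past determines.
\<close>

definition mixed_residual :: "nat \<Rightarrow> 'w \<Rightarrow> real^'p" where
  "mixed_residual k \<omega> = (1 - \<gamma>) *\<^sub>R residual k \<omega> - \<gamma> *\<^sub>R lagged_residual k \<omega>"

text \<open>
  The distance vector to \<open>xstar\<close> of the shifted point \<open>y k\<close> of the introduction.
\<close>

definition shifted_error :: "nat \<Rightarrow> 'w \<Rightarrow> real^'p" where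
  "shifted_error k \<omega> = (x k \<omega> - xstar) + (\<gamma> * \<eta>) *\<^sub>R lagged_residual k \<omega>"

abbreviation Esq :: "('w \<Rightarrow> real^'p) \<Rightarrow> real" where
  "Esq f \<equiv> \<integral>\<omega>. (norm (f \<omega>))\<^sup>2 \<partial>P"

lemma prev_simps [simp]: "prev 0 = x 0" "prev (Suc k) = x k"
  by (simp_all add: lag_def)

lemma v_in_T: "\<omega> \<in> space P \<Longrightarrow> v k \<omega> \<in> T (x k \<omega>)"
  using init v_step by (cases k) auto

lemma displacement:
  assumes "\<omega> \<in> space P"
  shows "x (Suc k) \<omega> - x k \<omega> = - (\<eta> *\<^sub>R (\<gamma> *\<^sub>R lagged_residual (Suc k) \<omega> + (mixed_residual k \<omega> + err k \<omega>)))"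
proof -
  have S: "S k \<omega> = err k \<omega> + G (x k \<omega>) - \<gamma> *\<^sub>R G (prev k \<omega>)"
    by (simp add: err_def reflected_dir_def)
  show ?thesis
    unfolding x_step[OF assms] S
    by (simp add: vec_eq_iff lagged_residual_def mixed_residual_def residual_def algebra_simps)
qed

text \<open>
  The lagged residual of the next iterate, which involves the implicitly defined \<open>v (Suc k)\<close>, cancels:
  what remains is an explicit step along \<open>residual k\<close>.
\<close>

lemma shifted_error_step:
  assumes "\<omega> \<in> space P"
  shows "shifted_error (Suc k) \<omega> = (shifted_error k \<omega> - (\<eta> * (1 - \<gamma>)) *\<^sub>R residual k \<omega>) + (- \<eta>) *\<^sub>R err k \<omega>"
proof -
  have "shifted_error (Suc k) \<omega>
      = (x k \<omega> - xstar) + (x (Suc k) \<omega> - x k \<omega>) + (\<gamma> * \<eta>) *\<^sub>R lagged_residual (Suc k) \<omega>"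
    by (simp add: shifted_error_def)
  then show ?thesis
    unfolding displacement[OF assms] by (simp add: shifted_error_def mixed_residual_def algebra_simps)
qed

lemma norm_Gi_diff_le:
  assumes "i \<in> {1..n}"
  shows "norm (Gi i y - Gi i z) \<le> sqrt (real n) * L * norm (y - z)"
proof -
  have "(norm (Gi i y - Gi i z))\<^sup>2 \<le> (\<Sum>i=1..n. (norm (Gi i y - Gi i z))\<^sup>2)"
    using assms by (intro member_le_sum) auto
  also have "\<dots> \<le> real n * (L\<^sup>2 * (norm (y - z))\<^sup>2)"
    using Lipschitz[of y z] n_pos by (simp add: field_simps)
  also have "\<dots> = (sqrt (real n) * L * norm (y - z))\<^sup>2"
    by (simp add: power_mult_distrib)
  finally show ?thesis
    by (rule power2_le_imp_le) (use L_pos in auto)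
qed

lemma norm_G_diff_sq_le: "(norm (G y - G z))\<^sup>2 \<le> L\<^sup>2 * (norm (y - z))\<^sup>2"
  using norm_avg_op_diff_sq_le[OF n_pos, of Gi y z] Lipschitz[of y z] by linarith

lemma norm_G_diff_le: "norm (G y - G z) \<le> L * norm (y - z)"
proof (rule power2_le_imp_le)
  show "(norm (G y - G z))\<^sup>2 \<le> (L * norm (y - z))\<^sup>2"
    using norm_G_diff_sq_le[of y z] unfolding power_mult_distrib .
  show "0 \<le> L * norm (y - z)"
    using L_pos by simp
qed

lemma G_measurable [measurable]: "G \<in> borel_measurable borel"
  using norm_G_diff_le L_pos by (intro borel_measurable_lipschitz[of G L]) auto

lemma sq_integrable_G: "sq_integrable P f \<Longrightarrow> sq_integrable P (\<lambda>\<omega>. G (f \<omega>))"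
  by (rule sq_integrable_lipschitz[OF finite_measure_axioms G_measurable norm_G_diff_le])

lemma sq_integrable_S:
  assumes "sq_integrable P (x k)" "sq_integrable P (prev k)"
  shows "sq_integrable P (err k)" "sq_integrable P (S k)"
proof -
  have d: "sq_integrable P (\<lambda>\<omega>. reflected_dir G \<gamma> x k \<omega>)"
    unfolding reflected_dir_def by (intro sq_integrable_intros sq_integrable_G assms)
  show e: "sq_integrable P (err k)"
    using error_integrable[of k] S_measurable[of k] sq_integrableD(1)[OF d]
    by (simp add: sq_integrable_def err_def[abs_def])
  have "S k = (\<lambda>\<omega>. err k \<omega> + reflected_dir G \<gamma> x k \<omega>)"
    by (simp add: err_def[abs_def])
  then show "sq_integrable P (S k)"
    using sq_integrable_add[OF e d] by simp
qed

text \<open>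
  The implicit update fixes \<open>x (Suc k) + \<eta> \<gamma> v (Suc k)\<close> explicitly in terms of the past.  The resolvent
  recovers \<open>x (Suc k)\<close> from it and increases no distance to \<open>x0\<close>, which is the resolvent of
  \<open>x0 + \<eta> \<gamma> v0\<close>.
\<close>

lemma sq_integrable_step:
  assumes S: "sq_integrable P (S k)" and x: "sq_integrable P (x k)" and v: "sq_integrable P (v k)"
  shows "sq_integrable P (x (Suc k))" "sq_integrable P (v (Suc k))"
proof -
  define c where "c = \<eta> * \<gamma>"
  have c: "c > 0"
    using eta_pos gamma by (simp add: c_def)
  let ?Z = "\<lambda>\<omega>. x (Suc k) \<omega> + c *\<^sub>R v (Suc k) \<omega>"
  have "sq_integrable P (\<lambda>\<omega>. x k \<omega> - \<eta> *\<^sub>R S k \<omega> + (\<eta> * (2 * \<gamma> - 1)) *\<^sub>R v k \<omega>)"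
    by (intro sq_integrable_intros S x v)
  also have "?this \<longleftrightarrow> sq_integrable P ?Z"
    by (intro sq_integrable_cong) (simp add: x_step c_def algebra_simps)
  finally have Z: "sq_integrable P ?Z" .
  have const: "sq_integrable P (\<lambda>\<omega>. a)" for a :: "real^'p"
    by (rule sq_integrable_const[OF finite_measure_axioms])
  have meas: "x (Suc k) \<in> borel_measurable P"
    by (rule resolvent_measurable[OF T_monotone less_imp_le[OF c] sq_integrableD(1)[OF Z] v_step])
  have "sq_integrable P (\<lambda>\<omega>. x (Suc k) \<omega> - x0)"
  proof (rule sq_integrable_bound)
    show "sq_integrable P (\<lambda>\<omega>. ?Z \<omega> - (x0 + c *\<^sub>R v0))"
      by (intro sq_integrable_diff Z const)
    show "norm (x (Suc k) \<omega> - x0) \<le> norm (?Z \<omega> - (x0 + c *\<^sub>R v0))" if "\<omega> \<in> space P" for \<omega>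
      using monotone_resolvent_nonexpansive[OF T_monotone less_imp_le[OF c] v_step[OF that] init(1)] .
  qed (use meas in measurable)
  from sq_integrable_add[OF this const[of x0]]
  show x': "sq_integrable P (x (Suc k))"
    by simp
  have "v (Suc k) = (\<lambda>\<omega>. (1 / c) *\<^sub>R (?Z \<omega> - x (Suc k) \<omega>))"
    using c by simp
  then show "sq_integrable P (v (Suc k))"
    using sq_integrable_scaleR[OF sq_integrable_diff[OF Z x'], of "1 / c"] by simp
qed

lemma iterates_sq_integrable:
  "sq_integrable P (x k)" "sq_integrable P (prev k)" "sq_integrable P (v k)"
proof -
  have "sq_integrable P (x k) \<and> sq_integrable P (prev k) \<and> sq_integrable P (v k)"
  proof (induction k)
    case 0
    have "sq_integrable P (x 0) \<longleftrightarrow> sq_integrable P (\<lambda>\<omega>. x0)"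
         "sq_integrable P (v 0) \<longleftrightarrow> sq_integrable P (\<lambda>\<omega>. v0)"
      by (intro sq_integrable_cong; simp add: init)+
    then show ?case
      by (simp add: sq_integrable_const[OF finite_measure_axioms])
  next
    case (Suc k)
    then show ?case
      using sq_integrable_S(2)[of k] sq_integrable_step[of k] by simp
  qed
  then show "sq_integrable P (x k)" "sq_integrable P (prev k)" "sq_integrable P (v k)"
    by auto
qed

lemma process_sq_integrable:
  "sq_integrable P (err k)" "sq_integrable P (residual k)" "sq_integrable P (lagged_residual k)"
  "sq_integrable P (mixed_residual k)" "sq_integrable P (shifted_error k)"
  "sq_integrable P (\<lambda>\<omega>. x k \<omega> - prev k \<omega>)"
proof -
  show e: "sq_integrable P (err k)"
    by (rule sq_integrable_S(1)) (rule iterates_sq_integrable)+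
  show r: "sq_integrable P (residual k)"
    unfolding residual_def by (intro sq_integrable_intros sq_integrable_G iterates_sq_integrable)
  show l: "sq_integrable P (lagged_residual k)"
    unfolding lagged_residual_def by (intro sq_integrable_intros sq_integrable_G iterates_sq_integrable)
  show "sq_integrable P (mixed_residual k)"
    unfolding mixed_residual_def by (intro sq_integrable_intros r l)
  show "sq_integrable P (shifted_error k)"
    unfolding shifted_error_def
    by (intro sq_integrable_intros l iterates_sq_integrable sq_integrable_const finite_measure_axioms)
  show "sq_integrable P (\<lambda>\<omega>. x k \<omega> - prev k \<omega>)"
    by (intro sq_integrable_intros iterates_sq_integrable)
qed

lemma space_iterate_algebra: "space (iterate_algebra P x v k) = space P"
  unfolding iterate_algebra_def by (rule space_measure_of) auto

lemma sets_iterate_algebra: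
  "sets (iterate_algebra P x v k) = sigma_sets (space P)
     (\<Union>j\<le>k. {x j -` A \<inter> space P | A. A \<in> sets borel} \<union> {v j -` A \<inter> space P | A. A \<in> sets borel})"
  unfolding iterate_algebra_def by (rule sets_measure_of) auto

lemma subalgebra_iterate_algebra: "finite_measure_subalgebra P (iterate_algebra P x v k)"
proof
  have "(\<Union>j\<le>k. {x j -` A \<inter> space P | A. A \<in> sets borel} \<union> {v j -` A \<inter> space P | A. A \<in> sets borel})
      \<subseteq> sets P"
    using sq_integrableD(1)[OF iterates_sq_integrable(1)] sq_integrableD(1)[OF iterates_sq_integrable(3)]
    by (auto intro: measurable_sets)
  then show "subalgebra P (iterate_algebra P x v k)"
    unfolding subalgebra_def space_iterate_algebra sets_iterate_algebra
    by (simp add: sets.sigma_sets_subset)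
qed

lemma iterates_adapted [measurable]:
  "x k \<in> borel_measurable (iterate_algebra P x v k)"
  "prev k \<in> borel_measurable (iterate_algebra P x v k)"
  "v k \<in> borel_measurable (iterate_algebra P x v k)"
proof -
  have "x j \<in> borel_measurable (iterate_algebra P x v k)" if "j \<le> k" for j
    by (rule measurableI; unfold space_iterate_algebra sets_iterate_algebra)
      (auto intro!: sigma_sets.Basic UN_I[of j] simp: that)
  moreover have "v j \<in> borel_measurable (iterate_algebra P x v k)" if "j \<le> k" for j
    by (rule measurableI; unfold space_iterate_algebra sets_iterate_algebra)
      (auto intro!: sigma_sets.Basic UN_I[of j] simp: that)
  ultimately show "x k \<in> borel_measurable (iterate_algebra P x v k)"
    "prev k \<in> borel_measurable (iterate_algebra P x v k)"
    "v k \<in> borel_measurable (iterate_algebra P x v k)"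
    by (auto simp: lag_def split: nat.split)
qed

lemma process_adapted [measurable]:
  "residual k \<in> borel_measurable (iterate_algebra P x v k)"
  "lagged_residual k \<in> borel_measurable (iterate_algebra P x v k)"
  "mixed_residual k \<in> borel_measurable (iterate_algebra P x v k)"
  "shifted_error k \<in> borel_measurable (iterate_algebra P x v k)"
proof -
  show r [measurable]: "residual k \<in> borel_measurable (iterate_algebra P x v k)"
    unfolding residual_def by measurable
  show l [measurable]: "lagged_residual k \<in> borel_measurable (iterate_algebra P x v k)"
    unfolding lagged_residual_def by measurable
  show "mixed_residual k \<in> borel_measurable (iterate_algebra P x v k)"
    unfolding mixed_residual_def by measurable
  show "shifted_error k \<in> borel_measurable (iterate_algebra P x v k)"
    unfolding shifted_error_def by measurable
qed

lemma expectation_sq_add_err: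
  assumes "sq_integrable P f" "f \<in> borel_measurable (iterate_algebra P x v k)"
  shows "Esq (\<lambda>\<omega>. f \<omega> + c *\<^sub>R err k \<omega>) = Esq f + c\<^sup>2 * Esq (err k)"
  using unbiased[of k]
  by (intro finite_measure_subalgebra.expectation_sq_add_unbiased[OF subalgebra_iterate_algebra assms]
      process_sq_integrable) (simp add: err_def[abs_def])

text \<open>
  Only the splitting into \<open>lagged_residual (Suc k)\<close> and the rest costs a factor 2: the error is
  orthogonal to \<open>mixed_residual k\<close>, but not to the lagged residual of the next iterate, which depends
  on it.
\<close>

lemma expected_displacement_le:
  "Esq (\<lambda>\<omega>. x (Suc k) \<omega> - x k \<omega>)
     \<le> 2 * \<eta>\<^sup>2 * (\<gamma>\<^sup>2 * Esq (lagged_residual (Suc k)) + Esq (mixed_residual k) + Esq (err k))"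
proof -
  note [simp] = process_sq_integrable[THEN sq_integrableD(2)]
  have me: "sq_integrable P (\<lambda>\<omega>. mixed_residual k \<omega> + 1 *\<^sub>R err k \<omega>)"
    by (intro sq_integrable_intros process_sq_integrable)
  have "Esq (\<lambda>\<omega>. x (Suc k) \<omega> - x k \<omega>)
      \<le> (\<integral>\<omega>. 2 * \<eta>\<^sup>2 * (\<gamma>\<^sup>2 * (norm (lagged_residual (Suc k) \<omega>))\<^sup>2 + (norm (mixed_residual k \<omega> + 1 *\<^sub>R err k \<omega>))\<^sup>2) \<partial>P)"
  proof (rule integral_mono)
    show "integrable P (\<lambda>\<omega>. (norm (x (Suc k) \<omega> - x k \<omega>))\<^sup>2)"
      using process_sq_integrable(6)[of "Suc k"] by (simp add: sq_integrable_def)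
    show "integrable P (\<lambda>\<omega>. 2 * \<eta>\<^sup>2 * (\<gamma>\<^sup>2 * (norm (lagged_residual (Suc k) \<omega>))\<^sup>2
              + (norm (mixed_residual k \<omega> + 1 *\<^sub>R err k \<omega>))\<^sup>2))"
      using sq_integrableD(2)[OF me] by auto
    fix \<omega> assume \<omega>: "\<omega> \<in> space P"
    have "(norm (x (Suc k) \<omega> - x k \<omega>))\<^sup>2
        = \<eta>\<^sup>2 * (norm (\<gamma> *\<^sub>R lagged_residual (Suc k) \<omega> + (mixed_residual k \<omega> + err k \<omega>)))\<^sup>2"
      unfolding displacement[OF \<omega>] norm_minus_cancel norm_scaleR by (simp add: power_mult_distrib)
    then show "(norm (x (Suc k) \<omega> - x k \<omega>))\<^sup>2
        \<le> 2 * \<eta>\<^sup>2 * (\<gamma>\<^sup>2 * (norm (lagged_residual (Suc k) \<omega>))\<^sup>2 + (norm (mixed_residual k \<omega> + 1 *\<^sub>R err k \<omega>))\<^sup>2)"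
      using mult_left_mono[OF norm_add_sq_le[of "\<gamma> *\<^sub>R lagged_residual (Suc k) \<omega>" "mixed_residual k \<omega> + err k \<omega>"],
          of "\<eta>\<^sup>2"]
      by (simp add: power_mult_distrib algebra_simps)
  qed
  also have "\<dots> = 2 * \<eta>\<^sup>2 * (\<gamma>\<^sup>2 * Esq (lagged_residual (Suc k)) + Esq (\<lambda>\<omega>. mixed_residual k \<omega> + 1 *\<^sub>R err k \<omega>))"
    using sq_integrableD(2)[OF me] by simp
  also have "\<dots> = 2 * \<eta>\<^sup>2 * (\<gamma>\<^sup>2 * Esq (lagged_residual (Suc k)) + Esq (mixed_residual k) + Esq (err k))"
    unfolding expectation_sq_add_err[OF process_sq_integrable(4) process_adapted(3)] by simp
  finally show ?thesis .
qed

text \<open>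
  The error enters with total weight \<open>(3 \<gamma> - 1) \<eta>\<^sup>2\<close>.  It is written as \<open>2 \<gamma> \<eta>\<^sup>2\<close> minus
  \<open>(1 - \<gamma>) \<eta>\<^sup>2\<close>, so that the last line carries the same combination as the bound on the
  displacement, with the index of the lagged residual shifted by one.
\<close>

lemma expected_shifted_error_descent:
  "(3 * \<gamma> - 1) * Esq (shifted_error (Suc k))
     \<le> (3 * \<gamma> - 1) * Esq (shifted_error k)
       - 2 * \<eta> * (1 - \<gamma>) * (\<gamma> * (2 * \<gamma> - 1) * \<eta> - (3 * \<gamma> - 1) * \<kappa>) * Esq (residual k)
       + 2 * \<gamma> * \<eta>\<^sup>2 * (\<gamma> * (1 - \<gamma>) * L\<^sup>2 * Esq (\<lambda>\<omega>. x k \<omega> - prev k \<omega>) + Esq (err k))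
       - \<eta>\<^sup>2 * (1 - \<gamma>) * (\<gamma>\<^sup>2 * Esq (lagged_residual k) + Esq (mixed_residual k) + Esq (err k))"
proof -
  note [simp] = process_sq_integrable[THEN sq_integrableD(2)]
  let ?a = "\<lambda>\<omega>. shifted_error k \<omega> - (\<eta> * (1 - \<gamma>)) *\<^sub>R residual k \<omega>"
  have a: "sq_integrable P ?a"
    by (intro sq_integrable_intros process_sq_integrable)
  have "Esq (shifted_error (Suc k)) = Esq (\<lambda>\<omega>. ?a \<omega> + (- \<eta>) *\<^sub>R err k \<omega>)"
    by (rule Bochner_Integration.integral_cong) (simp_all only: shifted_error_step)
  also have "\<dots> = Esq ?a + \<eta>\<^sup>2 * Esq (err k)"
    by (subst expectation_sq_add_err[OF a]) 
      (auto intro!: borel_measurable_diff borel_measurable_scaleR borel_measurable_const process_adapted)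
  finally have step: "Esq (shifted_error (Suc k)) = Esq ?a + \<eta>\<^sup>2 * Esq (err k)" .
  let ?b = "\<lambda>\<omega>. (3 * \<gamma> - 1) * (norm (shifted_error k \<omega>))\<^sup>2
       - 2 * \<eta> * (1 - \<gamma>) * (\<gamma> * (2 * \<gamma> - 1) * \<eta> - (3 * \<gamma> - 1) * \<kappa>) * (norm (residual k \<omega>))\<^sup>2
       + 2 * \<gamma>\<^sup>2 * \<eta>\<^sup>2 * (1 - \<gamma>) * L\<^sup>2 * (norm (x k \<omega> - prev k \<omega>))\<^sup>2
       - \<eta>\<^sup>2 * (1 - \<gamma>) * \<gamma>\<^sup>2 * (norm (lagged_residual k \<omega>))\<^sup>2 - \<eta>\<^sup>2 * (1 - \<gamma>) * (norm (mixed_residual k \<omega>))\<^sup>2"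
  have "(3 * \<gamma> - 1) * Esq ?a = (\<integral>\<omega>. (3 * \<gamma> - 1) * (norm (?a \<omega>))\<^sup>2 \<partial>P)"
    by simp
  also have "\<dots> \<le> (\<integral>\<omega>. ?b \<omega> \<partial>P)"
  proof (rule integral_mono)
    show "integrable P (\<lambda>\<omega>. (3 * \<gamma> - 1) * (norm (?a \<omega>))\<^sup>2)"
      using sq_integrableD(2)[OF a] by simp
    show "integrable P ?b"
      by (intro Bochner_Integration.integrable_diff Bochner_Integration.integrable_add
          integrable_mult_right) simp_all
    fix \<omega> assume \<omega>: "\<omega> \<in> space P"
    \<comment> \<open>the weak Minty condition\<close>
    have "0 \<le> 2 * \<eta> * (3 * \<gamma> - 1) * (1 - \<gamma>)
        * (inner (residual k \<omega>) (x k \<omega> - xstar) + \<kappa> * (norm (residual k \<omega>))\<^sup>2)"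
      using weak_Minty[OF v_in_T[OF \<omega>], of k] gamma eta_pos by (simp add: residual_def)
    \<comment> \<open>the Lipschitz condition, as the two residuals differ by the change of \<open>G\<close>\<close>
    moreover have "0 \<le> 2 * \<gamma>\<^sup>2 * \<eta>\<^sup>2 * (1 - \<gamma>)
        * (L\<^sup>2 * (norm (x k \<omega> - prev k \<omega>))\<^sup>2 - (norm (residual k \<omega> - lagged_residual k \<omega>))\<^sup>2)"
      using norm_G_diff_sq_le[of "x k \<omega>" "prev k \<omega>"] gamma by (simp add: residual_def lagged_residual_def)
    moreover have "(3 * \<gamma> - 1) * (norm (?a \<omega>))\<^sup>2
       = (3 * \<gamma> - 1) * (norm (shifted_error k \<omega>))\<^sup>2
         - 2 * \<eta> * (3 * \<gamma> - 1) * (1 - \<gamma>) * inner (residual k \<omega>) (x k \<omega> - xstar)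
         + \<eta>\<^sup>2 * (1 - \<gamma>) * (2 * \<gamma>\<^sup>2 * (norm (residual k \<omega> - lagged_residual k \<omega>))\<^sup>2
             - 2 * \<gamma> * (2 * \<gamma> - 1) * (norm (residual k \<omega>))\<^sup>2
             - (norm (mixed_residual k \<omega>))\<^sup>2 - \<gamma>\<^sup>2 * (norm (lagged_residual k \<omega>))\<^sup>2)"
      unfolding shifted_error_def mixed_residual_def by (rule descent_identity)
    ultimately show "(3 * \<gamma> - 1) * (norm (?a \<omega>))\<^sup>2 \<le> ?b \<omega>"
      by (simp add: algebra_simps power2_eq_square)
  qed
  also have "\<dots> = (3 * \<gamma> - 1) * Esq (shifted_error k)
       - 2 * \<eta> * (1 - \<gamma>) * (\<gamma> * (2 * \<gamma> - 1) * \<eta> - (3 * \<gamma> - 1) * \<kappa>) * Esq (residual k)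
       + 2 * \<gamma>\<^sup>2 * \<eta>\<^sup>2 * (1 - \<gamma>) * L\<^sup>2 * Esq (\<lambda>\<omega>. x k \<omega> - prev k \<omega>)
       - \<eta>\<^sup>2 * (1 - \<gamma>) * \<gamma>\<^sup>2 * Esq (lagged_residual k) - \<eta>\<^sup>2 * (1 - \<gamma>) * Esq (mixed_residual k)"
    by simp
  finally show ?thesis
    unfolding step by (simp add: algebra_simps power2_eq_square)
qed

lemma mean_sq_change_le: "mean_sq_change P n Gi x k \<le> L\<^sup>2 * Esq (\<lambda>\<omega>. x k \<omega> - prev k \<omega>)"
proof -
  have int: "integrable P (\<lambda>\<omega>. (norm (Gi i (x k \<omega>) - Gi i (prev k \<omega>)))\<^sup>2)" if "i \<in> {1..n}" for i
  proof (rule sq_integrableD(2), rule sq_integrable_lipschitz_diff[where F = "Gi i"])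
    show "norm (Gi i y - Gi i z) \<le> sqrt (real n) * L * norm (y - z)" for y z
      by (rule norm_Gi_diff_le[OF that])
    then show "Gi i \<in> borel_measurable borel"
      by (rule borel_measurable_lipschitz) (use L_pos in simp)
  qed (rule iterates_sq_integrable)+
  have "mean_sq_change P n Gi x k
      = (\<integral>\<omega>. (1 / real n) * (\<Sum>i=1..n. (norm (Gi i (x k \<omega>) - Gi i (prev k \<omega>)))\<^sup>2) \<partial>P)"
    using int by (simp add: mean_sq_change_def)
  also have "\<dots> \<le> (\<integral>\<omega>. L\<^sup>2 * (norm (x k \<omega> - prev k \<omega>))\<^sup>2 \<partial>P)"
  proof (rule integral_mono)
    show "integrable P (\<lambda>\<omega>. (1 / real n) * (\<Sum>i=1..n. (norm (Gi i (x k \<omega>) - Gi i (prev k \<omega>)))\<^sup>2))"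
      by (intro integrable_mult_right Bochner_Integration.integrable_sum int)
    show "integrable P (\<lambda>\<omega>. L\<^sup>2 * (norm (x k \<omega> - prev k \<omega>))\<^sup>2)"
      by (intro integrable_mult_right sq_integrableD(2) process_sq_integrable(6))
  qed (rule Lipschitz)
  finally show ?thesis
    by simp
qed

lemma sum_Esq_err_le:
  "(\<Sum>k=0..K. Esq (err k)) \<le> (C + C') / \<rho> * L\<^sup>2 * (\<Sum>k=0..K. Esq (\<lambda>\<omega>. x k \<omega> - prev k \<omega>))"
proof -
  have U: "mean_sq_change P n Gi x k \<ge> 0" for k
    by (simp add: mean_sq_change_def sum_nonneg)
  have "(\<Sum>k=0..K. Esq (err k)) \<le> (\<Sum>k=0..K. \<Delta> k)"
    using error_le by (intro sum_mono) (simp add: err_def)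
  also have "\<dots> \<le> (C + C') / \<rho> * (\<Sum>k=0..K. mean_sq_change P n Gi x k)"
    by (rule sum_variance_recursion[OF rho C_nonneg \<Delta>_nonneg U \<Delta>_rec])
  also have "\<dots> \<le> (C + C') / \<rho> * (\<Sum>k=0..K. L\<^sup>2 * Esq (\<lambda>\<omega>. x k \<omega> - prev k \<omega>))"
    using C_nonneg rho by (intro mult_left_mono sum_mono mean_sq_change_le) auto
  finally show ?thesis
    by (simp add: sum_distrib_left mult.assoc)
qed

lemma Esq_shifted_error_0_le:
  "Esq (shifted_error 0) \<le> 2 * ((norm (x0 - xstar))\<^sup>2 + \<gamma>\<^sup>2 * \<eta>\<^sup>2 * (norm (G x0 + v0))\<^sup>2)"
proof -
  have "Esq (shifted_error 0) = (\<integral>\<omega>. (norm ((x0 - xstar) + (\<gamma> * \<eta>) *\<^sub>R (G x0 + v0)))\<^sup>2 \<partial>P)"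
    by (rule Bochner_Integration.integral_cong) (simp_all add: shifted_error_def lagged_residual_def init)
  also have "\<dots> = (norm ((x0 - xstar) + (\<gamma> * \<eta>) *\<^sub>R (G x0 + v0)))\<^sup>2"
    by (simp add: prob_space)
  also have "\<dots> \<le> 2 * (norm (x0 - xstar))\<^sup>2 + 2 * (norm ((\<gamma> * \<eta>) *\<^sub>R (G x0 + v0)))\<^sup>2"
    by (rule norm_add_sq_le)
  finally show ?thesis
    by (simp add: power_mult_distrib)
qed

text \<open>
  The displacements \<open>1\<close> to \<open>K\<close> cost the lagged residuals \<open>1\<close> to \<open>K\<close> and the mixed residuals and
  errors \<open>0\<close> to \<open>K - 1\<close>; all of these are paid for by the negative terms of the descent
  inequalities \<open>0\<close> to \<open>K\<close>.
\<close>

lemma summed_descent: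
  "(1 - \<gamma>) / 2 * (1 - vfrbs_M \<gamma> \<rho> C C' * L\<^sup>2 * \<eta>\<^sup>2) * (\<Sum>k=0..K. Esq (\<lambda>\<omega>. x k \<omega> - prev k \<omega>))
     + 2 * \<eta> * (1 - \<gamma>) * (\<gamma> * (2 * \<gamma> - 1) * \<eta> - (3 * \<gamma> - 1) * \<kappa>) * (\<Sum>k=0..K. Esq (residual k))
   \<le> 2 * (3 * \<gamma> - 1) * ((norm (x0 - xstar))\<^sup>2 + \<gamma>\<^sup>2 * \<eta>\<^sup>2 * (norm (G x0 + v0))\<^sup>2)"
proof -
  define d where "d k = Esq (\<lambda>\<omega>. x k \<omega> - prev k \<omega>)" for k
  define q where "q k = \<gamma>\<^sup>2 * Esq (lagged_residual k) + Esq (mixed_residual k) + Esq (err k)" for k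
  define c where "c = 2 * \<eta> * (1 - \<gamma>) * (\<gamma> * (2 * \<gamma> - 1) * \<eta> - (3 * \<gamma> - 1) * \<kappa>)"
  have descent: "(3 * \<gamma> - 1) * Esq (shifted_error (Suc K)) + c * (\<Sum>k=0..K. Esq (residual k))
      \<le> (3 * \<gamma> - 1) * Esq (shifted_error 0)
        + 2 * \<gamma> * \<eta>\<^sup>2 * (\<gamma> * (1 - \<gamma>) * L\<^sup>2 * (\<Sum>k=0..K. d k) + (\<Sum>k=0..K. Esq (err k)))
        - \<eta>\<^sup>2 * (1 - \<gamma>) * (\<Sum>k=0..K. q k)"
  proof (induction K)
    case 0
    then show ?case
      using expected_shifted_error_descent[of 0] by (simp add: d_def q_def c_def)
  next
    case (Suc K)
    then show ?case
      using expected_shifted_error_descent[of "Suc K", folded d_def q_def c_def]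
      by (simp add: algebra_simps)
  qed
  \<comment> \<open>The displacement with index 0 vanishes, so this is the shifted sum of the displacement bounds.\<close>
  have displ: "(\<Sum>k=0..K. d k) \<le> 2 * \<eta>\<^sup>2 * (\<Sum>k=0..K. q k)"
  proof -
    \<comment> \<open>The terms subtracted belong to the displacement \<open>K + 1\<close>; the induction needs them.\<close>
    have "(\<Sum>k=0..K. d k) \<le> 2 * \<eta>\<^sup>2 * ((\<Sum>k=0..K. q k) - Esq (mixed_residual K) - Esq (err K))"
    proof (induction K)
      case 0
      then show ?case
        by (simp add: d_def q_def)
    next
      case (Suc K)
      then show ?case
        using expected_displacement_le[of K]
        by (simp add: d_def q_def algebra_simps)
    qed
    also have "\<dots> \<le> 2 * \<eta>\<^sup>2 * (\<Sum>k=0..K. q k)"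
    proof (rule mult_left_mono)
      have "0 \<le> Esq (mixed_residual K)" "0 \<le> Esq (err K)"
        by simp_all
      then show "(\<Sum>k=0..K. q k) - Esq (mixed_residual K) - Esq (err K) \<le> (\<Sum>k=0..K. q k)"
        by linarith
    qed simp
    finally show ?thesis .
  qed
  define s where "s = (\<Sum>k=0..K. d k)"
  have 1: "(1 - \<gamma>) / 2 * s \<le> \<eta>\<^sup>2 * (1 - \<gamma>) * (\<Sum>k=0..K. q k)"
  proof -
    have "(1 - \<gamma>) / 2 * s \<le> (1 - \<gamma>) / 2 * (2 * \<eta>\<^sup>2 * (\<Sum>k=0..K. q k))"
      unfolding s_def using gamma by (intro mult_left_mono displ) auto
    then show ?thesis
      by (simp add: mult_ac)
  qed
  have 2: "2 * \<gamma> * \<eta>\<^sup>2 * (\<Sum>k=0..K. Esq (err k)) \<le> 2 * \<gamma> * \<eta>\<^sup>2 * ((C + C') / \<rho> * L\<^sup>2 * s)"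
    using sum_Esq_err_le[of K] gamma by (intro mult_left_mono) (auto simp: s_def d_def)
  have 3: "0 \<le> (3 * \<gamma> - 1) * Esq (shifted_error (Suc K))"
    using gamma by simp
  define R where "R = (norm (x0 - xstar))\<^sup>2 + \<gamma>\<^sup>2 * \<eta>\<^sup>2 * (norm (G x0 + v0))\<^sup>2"
  have 4: "(3 * \<gamma> - 1) * Esq (shifted_error 0) \<le> 2 * (3 * \<gamma> - 1) * R"
  proof -
    have "(3 * \<gamma> - 1) * Esq (shifted_error 0) \<le> (3 * \<gamma> - 1) * (2 * R)"
      unfolding R_def using gamma by (intro mult_left_mono Esq_shifted_error_0_le) auto
    then show ?thesis
      by (simp only: mult_ac)
  qed
  define r where "r = (C + C') / \<rho>"
  \<comment> \<open>\<open>vfrbs_M\<close> collects the two factors in front of the total displacement.\<close>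
  have M: "(1 - \<gamma>) / 2 * vfrbs_M \<gamma> \<rho> C C' = 2 * \<gamma> * (\<gamma> * (1 - \<gamma>) + r)"
    using gamma by (simp add: vfrbs_M_def r_def[symmetric] field_simps power2_eq_square)
  have "(1 - \<gamma>) / 2 * (1 - vfrbs_M \<gamma> \<rho> C C' * L\<^sup>2 * \<eta>\<^sup>2) * s
      = (1 - \<gamma>) / 2 * s - ((1 - \<gamma>) / 2 * vfrbs_M \<gamma> \<rho> C C') * (L\<^sup>2 * \<eta>\<^sup>2 * s)"
    by (simp add: left_diff_distrib right_diff_distrib mult_ac)
  also have "\<dots> = (1 - \<gamma>) / 2 * s
      - (2 * \<gamma> * \<eta>\<^sup>2 * (\<gamma> * (1 - \<gamma>) * L\<^sup>2 * s) + 2 * \<gamma> * \<eta>\<^sup>2 * (r * L\<^sup>2 * s))"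
    unfolding M by (simp add: distrib_left distrib_right mult_ac)
  finally have "(1 - \<gamma>) / 2 * (1 - vfrbs_M \<gamma> \<rho> C C' * L\<^sup>2 * \<eta>\<^sup>2) * s
      + c * (\<Sum>k=0..K. Esq (residual k)) \<le> 2 * (3 * \<gamma> - 1) * R"
    using descent[folded s_def, unfolded distrib_left[of "2 * \<gamma> * \<eta>\<^sup>2"]]
      1 2[folded r_def] 3 4 by linarith
  then show ?thesis
    by (simp add: c_def s_def d_def R_def)
qed

end

section \<open>Ergodic bounds on residuals and displacements\<close>

theorem theorem4p1:
  fixes P :: "'w measure"
    and n :: nat
    and Gi :: "nat \<Rightarrow> real^'p \<Rightarrow> real^'p"
    and G :: "real^'p \<Rightarrow> real^'p"
    and T :: "real^'p \<Rightarrow> (real^'p) set"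
    and x v S :: "nat \<Rightarrow> 'w \<Rightarrow> real^'p"
    and x0 v0 xstar :: "real^'p"
    and \<gamma> \<rho> C C' L \<kappa> \<eta> R0sq :: real
  assumes P: "prob_space P"
    and gamma: "1/2 < \<gamma>" "\<gamma> < 1"
    and rho: "0 < \<rho>" "\<rho> \<le> 1"
    and C: "C \<ge> 0" "C' \<ge> 0"
    and n: "n \<ge> 1"
    and G: "G = avg_op n Gi"
    and zeros: "op_zeros G T \<noteq> {}"
    and T: "maximally_monotone T"
    and L: "L > 0"
    and Lipschitz:
      "\<And>y z. (1 / real n) * (\<Sum>i=1..n. (norm (Gi i y - Gi i z))\<^sup>2) \<le> L\<^sup>2 * (norm (y - z))\<^sup>2"
    and xstar: "xstar \<in> op_zeros G T"
    and kappa: "\<kappa> \<ge> 0"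
    and weak_Minty:
      "\<And>y u. y \<in> op_dom T \<Longrightarrow> u \<in> T y \<Longrightarrow>
         inner (G y + u) (y - xstar) \<ge> - \<kappa> * (norm (G y + u))\<^sup>2"
    and L_kappa: "L * \<kappa> < vfrbs_delta \<gamma> \<rho> C C'"
    and init: "x0 \<in> op_dom T" "v0 \<in> T x0"
      "\<And>\<omega>. \<omega> \<in> space P \<Longrightarrow> x 0 \<omega> = x0"
      "\<And>\<omega>. \<omega> \<in> space P \<Longrightarrow> v 0 \<omega> = v0"
    and S_init: "\<And>\<omega>. \<omega> \<in> space P \<Longrightarrow> S 0 \<omega> = (1 - \<gamma>) *\<^sub>R G x0"
    and estimator: "unbiased_vr_estimator P n Gi \<gamma> x v \<rho> C C' S"
    and x_step: "\<And>k \<omega>. \<omega> \<in> space P \<Longrightarrow>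
         x (Suc k) \<omega> = x k \<omega> - \<eta> *\<^sub>R S k \<omega>
           - \<eta> *\<^sub>R (\<gamma> *\<^sub>R v (Suc k) \<omega> - (2 * \<gamma> - 1) *\<^sub>R v k \<omega>)"
    and v_step: "\<And>k \<omega>. \<omega> \<in> space P \<Longrightarrow> v (Suc k) \<omega> \<in> T (x (Suc k) \<omega>)"
    and eta: "\<eta> > 0"
      "(3 * \<gamma> - 1) * \<kappa> / (\<gamma> * (2 * \<gamma> - 1)) < \<eta>"
      "\<eta> \<le> 1 / (L * sqrt (vfrbs_M \<gamma> \<rho> C C'))"
    and R0sq: "R0sq = (norm (x0 - xstar))\<^sup>2 + \<gamma>\<^sup>2 * \<eta>\<^sup>2 * (norm (G x0 + v0))\<^sup>2"
  shows "(\<forall>k. integrable P (\<lambda>\<omega>. (norm (G (x k \<omega>) + v k \<omega>))\<^sup>2) \<and>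
              integrable P (\<lambda>\<omega>. (norm (x k \<omega> - lag (x 0) x k \<omega>))\<^sup>2)) \<and>
         (\<forall>K::nat.
           1 / (real K + 1) * (\<Sum>k=0..K. \<integral>\<omega>. (norm (G (x k \<omega>) + v k \<omega>))\<^sup>2 \<partial>P)
             \<le> vfrbs_Theta1 \<gamma> \<kappa> \<eta> * R0sq / (\<eta>\<^sup>2 * (real K + 1)) \<and>
           (\<eta> \<noteq> 1 / (L * sqrt (vfrbs_M \<gamma> \<rho> C C')) \<longrightarrow>
             1 / (real K + 1) * (\<Sum>k=0..K. \<integral>\<omega>. (norm (x k \<omega> - lag (x 0) x k \<omega>))\<^sup>2 \<partial>P)
               \<le> vfrbs_Theta2 \<gamma> \<rho> C C' L \<eta> * R0sq / (real K + 1)))"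
proof -
  interpret prob_space P by (rule P)
  let ?err = "\<lambda>k \<omega>. S k \<omega> - reflected_dir (avg_op n Gi) \<gamma> x k \<omega>"
  let ?M = "vfrbs_M \<gamma> \<rho> C C'"
  from estimator[unfolded unbiased_vr_estimator_def Let_def]
  obtain \<Delta> where S: "\<And>k. S k \<in> borel_measurable P" and \<Delta>: "\<And>k. \<Delta> k \<ge> 0"
      "\<And>k. AE \<omega> in P. vec_cond_exp P (iterate_algebra P x v k) (?err k) \<omega> = 0"
      "\<And>k. integrable P (\<lambda>\<omega>. (norm (?err k \<omega>))\<^sup>2)"
      "\<And>k. (\<integral>\<omega>. (norm (?err k \<omega>))\<^sup>2 \<partial>P) \<le> \<Delta> k"
      "\<And>k. \<Delta> k \<le> (1 - \<rho>) * lag 0 \<Delta> k + C * mean_sq_change P n Gi x k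
                + C' * lag 0 (mean_sq_change P n Gi x) k"
    by blast
  interpret vfrbs P n Gi T x v S x0 v0 xstar \<gamma> \<rho> C C' L \<kappa> \<eta> \<Delta>
  proof
    show "monotone_operator T"
      using T by (simp add: maximally_monotone_def)
    show "inner (avg_op n Gi y + u) (y - xstar) \<ge> - \<kappa> * (norm (avg_op n Gi y + u))\<^sup>2"
      if "u \<in> T y" for y u
      using weak_Minty[of y u] that by (auto simp: G op_dom_def)
  qed (fact gamma rho C n L Lipschitz init S \<Delta> x_step v_step eta)+
  define a where "a K = (\<Sum>k=0..K. \<integral>\<omega>. (norm (G (x k \<omega>) + v k \<omega>))\<^sup>2 \<partial>P)" for K :: nat
  define d where "d K = (\<Sum>k=0..K. \<integral>\<omega>. (norm (x k \<omega> - lag (x 0) x k \<omega>))\<^sup>2 \<partial>P)" for K :: nat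
  define m where "m = \<gamma> * (2 * \<gamma> - 1) * \<eta> - (3 * \<gamma> - 1) * \<kappa>"
  have bound: "(1 - \<gamma>) * (1 - ?M * L\<^sup>2 * \<eta>\<^sup>2) * d K / 2 + 2 * (\<eta> * (1 - \<gamma>) * m * a K)
      \<le> 2 * ((3 * \<gamma> - 1) * R0sq)" for K
  proof -
    have "(1 - \<gamma>) / 2 * (1 - ?M * L\<^sup>2 * \<eta>\<^sup>2) * d K + 2 * \<eta> * (1 - \<gamma>) * m * a K
        \<le> 2 * (3 * \<gamma> - 1) * R0sq"
      using summed_descent[of K] by (simp add: a_def d_def m_def R0sq G residual_def)
    then show ?thesis
      by (simp only: mult.assoc times_divide_eq_left)
  qed
  have a: "a K \<ge> 0" and d: "d K \<ge> 0" for K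
    by (simp_all add: a_def d_def sum_nonneg)
  have m: "m > 0"
    using eta(2) gamma by (simp add: m_def divide_simps mult_ac split: if_splits)
  have M: "?M > 0"
    unfolding vfrbs_M_def using gamma rho C by (intro add_pos_nonneg) auto
  have eq: "?M * L\<^sup>2 * \<eta>\<^sup>2 = (\<eta> * (L * sqrt ?M))\<^sup>2"
    using M by (simp add: power_mult_distrib)
  have le: "\<eta> * (L * sqrt ?M) \<le> 1"
    using eta(3) M L by (simp add: field_simps)
  have le1: "?M * L\<^sup>2 * \<eta>\<^sup>2 \<le> 1"
    unfolding eq using le eta(1) L M by (intro power_le_one) auto
  have Theta1: "1 / (real K + 1) * a K \<le> vfrbs_Theta1 \<gamma> \<kappa> \<eta> * R0sq / (\<eta>\<^sup>2 * (real K + 1))" for K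
  proof -
    have "0 \<le> (1 - \<gamma>) * (1 - ?M * L\<^sup>2 * \<eta>\<^sup>2) * d K"
      using gamma le1 d by (intro mult_nonneg_nonneg) auto
    then have "\<eta> * (1 - \<gamma>) * m * a K \<le> (3 * \<gamma> - 1) * R0sq"
      using bound[of K] by linarith
    then have "a K \<le> (3 * \<gamma> - 1) * R0sq / (\<eta> * (1 - \<gamma>) * m)"
      using eta(1) gamma m by (subst pos_le_divide_eq) (auto simp: mult_ac)
    also have "\<dots> = vfrbs_Theta1 \<gamma> \<kappa> \<eta> * R0sq / \<eta>\<^sup>2"
      using eta(1) by (simp add: vfrbs_Theta1_def m_def[symmetric] power2_eq_square)
    finally have "a K / (real K + 1) \<le> vfrbs_Theta1 \<gamma> \<kappa> \<eta> * R0sq / \<eta>\<^sup>2 / (real K + 1)"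
      by (rule divide_right_mono) simp
    then show ?thesis
      by simp
  qed
  have Theta2: "1 / (real K + 1) * d K \<le> vfrbs_Theta2 \<gamma> \<rho> C C' L \<eta> * R0sq / (real K + 1)"
    if "\<eta> \<noteq> 1 / (L * sqrt ?M)" for K
  proof -
    have "\<eta> * (L * sqrt ?M) < 1"
      using le that L M by (auto simp: field_simps order_less_le)
    then have pos: "0 < 1 - ?M * L\<^sup>2 * \<eta>\<^sup>2"
      unfolding eq using eta(1) L M by (simp add: power_less_one_iff)
    have "0 \<le> \<eta> * (1 - \<gamma>) * m * a K"
      using eta(1) gamma m a by (intro mult_nonneg_nonneg) auto
    then have "(1 - \<gamma>) * (1 - ?M * L\<^sup>2 * \<eta>\<^sup>2) * d K \<le> 4 * ((3 * \<gamma> - 1) * R0sq)"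
      using bound[of K] by linarith
    then have "d K \<le> 4 * (3 * \<gamma> - 1) * R0sq / ((1 - \<gamma>) * (1 - ?M * L\<^sup>2 * \<eta>\<^sup>2))"
      using gamma pos by (subst pos_le_divide_eq) (auto simp: mult_ac)
    also have "\<dots> = vfrbs_Theta2 \<gamma> \<rho> C C' L \<eta> * R0sq"
      by (simp add: vfrbs_Theta2_def)
    finally have "d K / (real K + 1) \<le> vfrbs_Theta2 \<gamma> \<rho> C C' L \<eta> * R0sq / (real K + 1)"
      by (rule divide_right_mono) simp
    then show ?thesis
      by simp
  qed
  show ?thesis
    using process_sq_integrable(2,6)[THEN sq_integrableD(2)] Theta1 Theta2
    by (auto simp: residual_def G a_def d_def)
qed

end
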